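(* Let $G$ be a nontrivial finite group of order $n$ that is not a cyclic group of prime power order. Then $\lambda(\Gamma_G)\le 2n-4$, with equality if and only if $G$ is isomorphic to $\mathbb{Z}_2\times\mathbb{Z}_2$ or to $\mathbb{Z}_{2q}$ for some odd prime $q$.
   Context: The (undirected) power graph $\Gamma_G$ of a finite group $G$ has vertex set $G$, two distinct elements being adjacent if one is a power of the other. $\mathbb{Z}_m$ denotes the cyclic group of order $m$. An $L(2,1)$-labeling of a graph $\Gamma$ is a function $f:V(\Gamma)\to\mathbb{Z}_{\ge 0}$ such that $|f(u)-f(v)|\ge 2$ for adjacent $u,v$ and $|f(u)-f(v)|\ge 1$ for $u,v$ at distance two; its span is $\max f-\min f$, and $\lambda(\Gamma)$ is the minimum span over all $L(2,1)$-labelings of $\Gamma$. *)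

theory Defs
  imports
    "HOL-Algebra.Elementary_Groups"
    "HOL-Number_Theory.Prime_Powers"
    "HOL-Library.Extended_Nat"
begin

text \<open>
  A simple graph is a pair \<open>(V, E)\<close> whose edge set is coded as a symmetric irreflexive relation
  \<open>E \<subseteq> V \<times> V\<close>.
\<close>

type_synonym 'a graph = "'a set \<times> ('a \<times> 'a) set"

abbreviation verts :: "'a graph \<Rightarrow> 'a set" where
  "verts \<equiv> fst"

abbreviation edges :: "'a graph \<Rightarrow> ('a \<times> 'a) set" where
  "edges \<equiv> snd"

text \<open>The least length of a walk from \<open>u\<close> to \<open>v\<close>, and \<open>\<infinity>\<close> if there is none.\<close>

definition graph_dist :: "'a graph \<Rightarrow> 'a \<Rightarrow> 'a \<Rightarrow> enat" where
  "graph_dist \<Gamma> u v = (INF k \<in> {k :: nat. (u, v) \<in> edges \<Gamma> ^^ k}. enat k)"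

definition L21_labeling :: "'a graph \<Rightarrow> ('a \<Rightarrow> nat) \<Rightarrow> bool" where
  "L21_labeling \<Gamma> f \<longleftrightarrow>
     (\<forall>u \<in> verts \<Gamma>. \<forall>v \<in> verts \<Gamma>.
        ((u, v) \<in> edges \<Gamma> \<longrightarrow> \<bar>int (f u) - int (f v)\<bar> \<ge> 2) \<and>
        (graph_dist \<Gamma> u v = 2 \<longrightarrow> \<bar>int (f u) - int (f v)\<bar> \<ge> 1))"

definition label_span :: "'a graph \<Rightarrow> ('a \<Rightarrow> nat) \<Rightarrow> nat" where
  "label_span \<Gamma> f = Max (f ` verts \<Gamma>) - Min (f ` verts \<Gamma>)"

text \<open>
  The minimum exists for every finite graph with a vertex, as an injective labeling by even
  numbers is an \<open>L(2,1)\<close>-labeling.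
\<close>

definition lambda_number :: "'a graph \<Rightarrow> nat" where
  "lambda_number \<Gamma> = (LEAST s. \<exists>f. L21_labeling \<Gamma> f \<and> label_span \<Gamma> f = s)"

definition power_graph :: "('a, 'b) monoid_scheme \<Rightarrow> 'a graph" where
  "power_graph G =
     (carrier G,
      {(x, y). x \<in> carrier G \<and> y \<in> carrier G \<and> x \<noteq> y \<and>
         ((\<exists>k :: int. y = x [^]\<^bsub>G\<^esub> k) \<or> (\<exists>k :: int. x = y [^]\<^bsub>G\<^esub> k))})"

end

theory Submission
  imports
    Defs
    "HOL-Algebra.Multiplicative_Group"
begin

text \<open>
  Since the identity is adjacent to every other element, an \<open>L(2,1)\<close>-labeling is an injective
  labeling in which labels differing by 1 belong to nonadjacent elements. Listing the elements
  with a path on \<open>k\<close> vertices of the complement first and advancing the label by 1 along nonadjacent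
  neighbours and by 2 otherwise gives a span of at most \<open>2n - k - 1\<close>. Hence it suffices that the
  complement contains a path on four vertices outside the exceptional groups. If \<open>x\<close> and \<open>y\<close> are
  nonadjacent and have order at least 3, then \<open>x, y, x\<^sup>-\<^sup>1, y\<^sup>-\<^sup>1\<close> is such a path. Otherwise all elements
  of order at least 3 lie in one cyclic subgroup \<open>\<langle>c\<rangle>\<close>; an element \<open>t\<close> outside it yields the path
  \<open>c, t, ct, c\<^sup>2t\<close>, so \<open>G\<close> is cyclic, any two divisors of \<open>n\<close> that are at least 3 are comparable under
  divisibility, and \<open>n = 2q\<close>; if there are no elements of order at least 3, then \<open>G\<close> has exponent 2.
  In \<open>\<int>\<^sub>2\<^sub>q\<close> all elements but the involution form a clique, which gives the lower bound there.
\<close>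

section \<open>Distance and labelings in arbitrary graphs\<close>

lemma graph_dist_self: "graph_dist \<Gamma> u u = 0"
proof -
  have "graph_dist \<Gamma> u u \<le> enat 0"
    unfolding graph_dist_def by (rule INF_lower) simp
  then show ?thesis by (simp flip: zero_enat_def)
qed

lemma graph_dist_eq_2I:
  assumes "u \<noteq> v" "(u, v) \<notin> edges \<Gamma>" "(u, w) \<in> edges \<Gamma>" "(w, v) \<in> edges \<Gamma>"
  shows "graph_dist \<Gamma> u v = 2"
proof (rule antisym)
  have "(u, v) \<in> edges \<Gamma> ^^ 2"
    using assms(3,4) by (auto simp: numeral_2_eq_2)
  then have "graph_dist \<Gamma> u v \<le> enat 2"
    unfolding graph_dist_def by (intro INF_lower) simp
  then show "graph_dist \<Gamma> u v \<le> 2" by (simp add: numeral_eq_enat)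
  have "2 \<le> k" if "(u, v) \<in> edges \<Gamma> ^^ k" for k
  proof (rule ccontr)
    assume "\<not> 2 \<le> k"
    then have "k = 0 \<or> k = 1" by auto
    then show False using that assms(1,2) by auto
  qed
  then show "2 \<le> graph_dist \<Gamma> u v"
    unfolding graph_dist_def by (intro INF_greatest) (auto simp: numeral_eq_enat)
qed

lemma label_bounds:
  assumes "finite (verts \<Gamma>)" "u \<in> verts \<Gamma>"
  shows "Min (f ` verts \<Gamma>) \<le> f u" "f u \<le> Min (f ` verts \<Gamma>) + label_span \<Gamma> f"
proof -
  have "f u \<le> Max (f ` verts \<Gamma>)" "Min (f ` verts \<Gamma>) \<le> f u"
    using assms by auto
  then show "Min (f ` verts \<Gamma>) \<le> f u" "f u \<le> Min (f ` verts \<Gamma>) + label_span \<Gamma> f"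
    unfolding label_span_def by linarith+
qed

text \<open>Labels are assigned along the list, moving on by 2 across an edge and by 1 across a
  non-edge. Two moves already add up to at least 2, so only consecutive entries can be closer than
  2, and those only when nonadjacent. Each non-edge saves exactly one unit of
  \<open>2 * (length xs - 1)\<close>.\<close>

lemma lambda_number_le_enumeration:
  assumes sym: "sym (edges \<Gamma>)" and irr: "irrefl (edges \<Gamma>)"
    and xs: "distinct xs" "set xs = verts \<Gamma>" "xs \<noteq> []"
  shows "lambda_number \<Gamma> + card {i. Suc i < length xs \<and> (xs ! i, xs ! Suc i) \<notin> edges \<Gamma>}
    \<le> 2 * (length xs - 1)"
proof -
  define g :: "nat \<Rightarrow> nat" where "g j = (if (xs ! j, xs ! Suc j) \<in> edges \<Gamma> then 2 else 1)" for j
  define L where "L i = sum g {..<i}" for i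
  define f where "f = L \<circ> the_inv_into {..<length xs} ((!) xs)"
  have f: "f (xs ! i) = L i" if "i < length xs" for i
    using the_inv_into_f_f[of "(!) xs" "{..<length xs}" i] that xs(1)
    by (simp add: f_def inj_on_nth)
  have Lmono: "L i \<le> L j" if "i \<le> j" for i j
    unfolding L_def using that by (intro sum_mono2) auto
  have Lgap: "L i + (if (xs ! i, xs ! j) \<in> edges \<Gamma> then 2 else 1) \<le> L j" if "i < j" for i j
  proof (cases "j = Suc i")
    case True
    then show ?thesis by (simp add: L_def g_def)
  next
    case False
    have "L i + 2 \<le> L (Suc (Suc i))" by (simp add: L_def g_def)
    also have "\<dots> \<le> L j" using that False by (intro Lmono) simp
    finally show ?thesis by simp
  qed
  have lab: "((u, v) \<in> edges \<Gamma> \<longrightarrow> \<bar>int (f u) - int (f v)\<bar> \<ge> 2) \<and>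
      (u \<noteq> v \<longrightarrow> \<bar>int (f u) - int (f v)\<bar> \<ge> 1)"
    if uv: "u \<in> verts \<Gamma>" "v \<in> verts \<Gamma>" for u v
  proof (cases "u = v")
    case True
    then show ?thesis using irr by (auto simp: irrefl_def)
  next
    case False
    obtain i j where ij: "i < length xs" "j < length xs" "u = xs ! i" "v = xs ! j"
      using uv xs(2) by (metis in_set_conv_nth)
    then have "i \<noteq> j" using False by auto
    moreover have "(xs ! i, xs ! j) \<in> edges \<Gamma> \<longleftrightarrow> (xs ! j, xs ! i) \<in> edges \<Gamma>"
      using sym by (auto dest: symD)
    ultimately show ?thesis
      using Lgap[of i j] Lgap[of j i] f ij by (auto simp: linorder_neq_iff split: if_splits)
  qed
  \<comment> \<open>Vertices at distance two are distinct, because a vertex has distance 0 from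
    itself; injectivity of \<open>f\<close> therefore settles the second condition.\<close>
  have "L21_labeling \<Gamma> f"
    unfolding L21_labeling_def
    using lab graph_dist_self[of \<Gamma>] by (metis zero_neq_numeral)
  then have "lambda_number \<Gamma> \<le> label_span \<Gamma> f"
    unfolding lambda_number_def by (intro Least_le) auto
  also have "\<dots> \<le> Max (f ` verts \<Gamma>)" by (simp add: label_span_def)
  also have "\<dots> \<le> L (length xs - 1)"
  proof -
    have "f u \<le> L (length xs - 1)" if u: "u \<in> verts \<Gamma>" for u
    proof -
      obtain i where "i < length xs" "u = xs ! i" using u xs(2) by (metis in_set_conv_nth)
      then show ?thesis using f Lmono[of i "length xs - 1"] by simp
    qed
    moreover have "finite (verts \<Gamma>)" "verts \<Gamma> \<noteq> {}"
      using xs(2,3) by (simp_all flip: xs(2))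
    ultimately show ?thesis by (subst Max_le_iff) auto
  qed
  finally have *: "lambda_number \<Gamma> \<le> L (length xs - 1)" .
  \<comment> \<open>Written as a sum over positions, the count of non-edges fills every summand of
    \<open>L\<close> up to 2.\<close>
  have "{i. Suc i < length xs \<and> (xs ! i, xs ! Suc i) \<notin> edges \<Gamma>} =
      {..<length xs - 1} \<inter> {i. (xs ! i, xs ! Suc i) \<notin> edges \<Gamma>}" by auto
  then have "card {i. Suc i < length xs \<and> (xs ! i, xs ! Suc i) \<notin> edges \<Gamma>} =
      (\<Sum>i<length xs - 1. if (xs ! i, xs ! Suc i) \<notin> edges \<Gamma> then 1 else 0)"
    by (simp add: sum.If_cases)
  then have "L (length xs - 1) + card {i. Suc i < length xs \<and> (xs ! i, xs ! Suc i) \<notin> edges \<Gamma>} =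
      (\<Sum>i<length xs - 1. g i + (if (xs ! i, xs ! Suc i) \<notin> edges \<Gamma> then 1 else 0))"
    by (simp add: L_def sum.distrib)
  also have "\<dots> = (\<Sum>i<length xs - 1. 2)"
    by (intro sum.cong) (auto simp: g_def)
  finally show ?thesis using * by simp
qed

text \<open>With \<open>ys\<close> first and the other vertices in any order behind it, the list has
  at least \<open>length ys - 1\<close> consecutive non-edges. The additive form avoids truncated
  subtraction.\<close>

lemma lambda_number_le_nonadjacent_path:
  assumes "sym (edges \<Gamma>)" "irrefl (edges \<Gamma>)" "finite (verts \<Gamma>)"
    and ys: "distinct ys" "set ys \<subseteq> verts \<Gamma>" "ys \<noteq> []"
    and nonadj: "successively (\<lambda>x y. (x, y) \<notin> edges \<Gamma>) ys"
  shows "lambda_number \<Gamma> + length ys + 1 \<le> 2 * card (verts \<Gamma>)"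
proof -
  obtain zs where zs: "set zs = verts \<Gamma> - set ys" "distinct zs"
    using finite_distinct_list[of "verts \<Gamma> - set ys"] assms(3) by auto
  define xs where "xs = ys @ zs"
  have xs: "distinct xs" "set xs = verts \<Gamma>" "xs \<noteq> []"
    using ys zs by (auto simp: xs_def)
  then have len: "length xs = card (verts \<Gamma>)" by (metis distinct_card)
  have "{..<length ys - 1} \<subseteq> {i. Suc i < length xs \<and> (xs ! i, xs ! Suc i) \<notin> edges \<Gamma>}"
    using nonadj by (auto simp: xs_def nth_append successively_conv_nth)
  then have "length ys - 1 \<le> card {i. Suc i < length xs \<and> (xs ! i, xs ! Suc i) \<notin> edges \<Gamma>}"
    by (metis (no_types, lifting) card_lessThan card_mono finite_nat_set_iff_bounded mem_Collect_eq Suc_lessD)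
  with lambda_number_le_enumeration[OF assms(1,2) xs]
  have "lambda_number \<Gamma> + (length ys - 1) \<le> 2 * (length xs - 1)" by linarith
  moreover have "length ys \<ge> 1" "length xs \<ge> 1" using ys(3) xs(3) by (simp_all add: Suc_leI)
  ultimately show ?thesis using len by linarith
qed

text \<open>Doubling an injective numbering separates any two distinct vertices by at least 2. This
  makes the set under \<open>LEAST\<close> in \<open>lambda_number\<close> nonempty.\<close>

lemma L21_labeling_exists:
  assumes "irrefl (edges \<Gamma>)" "finite (verts \<Gamma>)"
  shows "\<exists>f. L21_labeling \<Gamma> f"
proof -
  obtain h :: "'a \<Rightarrow> nat" where h: "inj_on h (verts \<Gamma>)"
    using finite_imp_inj_to_nat_seg[OF assms(2)] by blast
  have ne: "u \<noteq> v" if "(u, v) \<in> edges \<Gamma> \<or> graph_dist \<Gamma> u v = 2" for u v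
    using that assms(1) graph_dist_self[of \<Gamma> u] by (auto simp: irrefl_def)
  have "\<bar>int (2 * h u) - int (2 * h v)\<bar> \<ge> 2"
    if "u \<in> verts \<Gamma>" "v \<in> verts \<Gamma>" "u \<noteq> v" for u v
    using inj_onD[OF h, of u v] that by linarith
  with ne have "L21_labeling \<Gamma> (\<lambda>x. 2 * h x)"
    unfolding L21_labeling_def by (smt (verit))
  then show ?thesis by blast
qed

lemma lambda_number_geI:
  assumes "irrefl (edges \<Gamma>)" "finite (verts \<Gamma>)"
    and "\<And>f. L21_labeling \<Gamma> f \<Longrightarrow> s \<le> label_span \<Gamma> f"
  shows "s \<le> lambda_number \<Gamma>"
proof -
  have "\<exists>t f. L21_labeling \<Gamma> f \<and> label_span \<Gamma> f = t"
    using L21_labeling_exists[OF assms(1,2)] by blast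
  from LeastI_ex[OF this] show ?thesis
    unfolding lambda_number_def using assms(3) by metis
qed

text \<open>Labels in a clique are pairwise at least 2 apart, so they stay distinct after shifting
  the minimum to 0 and halving. Hence \<open>card K\<close> is at most the number of values in
  \<open>{..label_span \<Gamma> f div 2}\<close>.\<close>

lemma lambda_number_ge_clique:
  assumes "irrefl (edges \<Gamma>)" "finite (verts \<Gamma>)" "K \<subseteq> verts \<Gamma>"
    and clique: "\<And>u v. u \<in> K \<Longrightarrow> v \<in> K \<Longrightarrow> u \<noteq> v \<Longrightarrow> (u, v) \<in> edges \<Gamma>"
  shows "2 * (card K - 1) \<le> lambda_number \<Gamma>"
proof (rule lambda_number_geI[OF assms(1,2)])
  fix f assume f: "L21_labeling \<Gamma> f"
  define m where "m = Min (f ` verts \<Gamma>)"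
  have m: "m \<le> f u" if "u \<in> K" for u
    unfolding m_def using that assms(3) by (intro label_bounds(1)[OF assms(2)]) auto
  have "inj_on (\<lambda>u. (f u - m) div 2) K"
  proof (rule inj_onI, rule ccontr)
    fix u v assume uv: "u \<in> K" "v \<in> K" "(f u - m) div 2 = (f v - m) div 2" "u \<noteq> v"
    then have "\<bar>int (f u) - int (f v)\<bar> \<ge> 2"
      using f clique assms(3) unfolding L21_labeling_def by blast
    with uv(3) m[OF uv(1)] m[OF uv(2)] show False by linarith
  qed
  moreover have "(\<lambda>u. (f u - m) div 2) ` K \<subseteq> {..label_span \<Gamma> f div 2}"
    using assms(2,3) by (auto simp: m_def label_span_def intro!: div_le_mono diff_le_mono)
  ultimately have "card K \<le> label_span \<Gamma> f div 2 + 1"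
    using card_inj_on_le[of _ K "{..label_span \<Gamma> f div 2}"] by fastforce
  then show "2 * (card K - 1) \<le> label_span \<Gamma> f" by linarith
qed

text \<open>A path in the complement graph. The empty list qualifies, so nonemptiness is required
  separately where it matters.\<close>

definition nonadjacent_path :: "'a graph \<Rightarrow> 'a list \<Rightarrow> bool" where
  "nonadjacent_path \<Gamma> ys \<longleftrightarrow>
     distinct ys \<and> set ys \<subseteq> verts \<Gamma> \<and> successively (\<lambda>x y. (x, y) \<notin> edges \<Gamma>) ys"

lemma verts_power_graph [simp]: "verts (power_graph G) = carrier G"
  by (simp add: power_graph_def)

lemma sym_power_graph: "sym (edges (power_graph G))"
  by (auto simp: power_graph_def sym_def)

lemma irrefl_power_graph: "irrefl (edges (power_graph G))"
  by (auto simp: power_graph_def irrefl_def)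

section \<open>Arithmetic of the order in the cyclic case\<close>

text \<open>Two different odd prime divisors would be incomparable, so the only prime divisors are 2
  and one odd \<open>q\<close>. A further factor 2 would make 4 and \<open>q\<close> incomparable
  divisors, and a further factor \<open>q\<close> would do so for \<open>q * q\<close> and
  \<open>2 * q\<close>.\<close>

lemma two_times_odd_prime_if_divisors_comparable:
  fixes N :: nat
  assumes "N > 1" "\<not> primepow N"
    and comp: "\<And>r s. r dvd N \<Longrightarrow> s dvd N \<Longrightarrow> r \<ge> 3 \<Longrightarrow> s \<ge> 3 \<Longrightarrow> r dvd s \<or> s dvd r"
  shows "\<exists>q. prime q \<and> odd q \<and> N = 2 * q"
proof -
  have ge3: "p \<ge> 3" if "prime p" "p \<noteq> 2" for p :: nat
    using prime_ge_2_nat[OF that(1)] that(2) by linarith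
  have same: "p = q" if "prime p" "prime q" "p dvd N" "q dvd N" "p \<noteq> 2" "q \<noteq> 2" for p q
    using comp[of p q] that ge3 primes_dvd_imp_eq by metis
  obtain p where p: "prime p" "p dvd N"
    using prime_factor_nat[of N] assms(1) by auto
  have "\<exists>r. prime r \<and> r dvd N \<and> r \<noteq> p"
  proof (rule ccontr)
    assume "\<not> (\<exists>r. prime r \<and> r dvd N \<and> r \<noteq> p)"
    moreover have "prime_factors N = {r. prime r \<and> r dvd N}"
      using assms(1) by (intro prime_factors_dvd) simp
    ultimately have "prime_factors N = {p}" using p by blast
    then have "N = p ^ multiplicity p N" using assms(1) prod_prime_factors[of N] by simp
    moreover from this have "multiplicity p N > 0" using assms(1) by (metis gr0I power_0 less_irrefl)
    ultimately have "primepow N" using p(1) by (metis primepow_prime_power)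
    then show False using assms(2) by simp
  qed
  then obtain r where r: "prime r" "r dvd N" "r \<noteq> p" by blast
  \<comment> \<open>By \<open>same\<close>, the distinct primes \<open>p\<close> and
    \<open>r\<close> cannot both be odd: one is 2 and the other serves as \<open>q\<close>.\<close>
  obtain q where q: "prime q" "q dvd N" "q \<noteq> 2" and two: "2 dvd N"
    using same[of p r] p r by metis
  have "odd q" using q by (metis primes_dvd_imp_eq two_is_prime_nat)
  then have "2 * q dvd N"
    using q two by (intro divides_mult) (auto simp: coprime_left_2_iff_odd)
  then obtain m where m: "N = 2 * q * m" by (auto elim: dvdE)
  have "m = 1"
  proof (rule ccontr)
    assume "m \<noteq> 1"
    then obtain l where l: "prime l" "l dvd m" using prime_factor_nat by blast
    then have "l dvd N" using m by simp
    then have "l = 2 \<or> l = q" using same[of l q] l q by blast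
    then show False
    proof
      assume "l = 2"
      then have "4 dvd N" using l m by (auto elim!: dvdE)
      then have "4 dvd q \<or> q dvd 4" using comp[of 4 q] q ge3 by auto
      moreover have "\<not> q dvd 2 ^ 2"
        using q by (metis prime_dvd_power primes_dvd_imp_eq two_is_prime_nat)
      moreover have "\<not> 4 dvd q" using \<open>odd q\<close> by presburger
      ultimately show False by simp
    next
      assume "l = q"
      then have "q * q dvd N" using l m by (auto elim!: dvdE)
      then have "q * q dvd 2 * q \<or> 2 * q dvd q * q"
        using comp[of "q * q" "2 * q"] \<open>2 * q dvd N\<close> ge3[OF q(1,3)] by (auto simp: le_square
          intro: order_trans[OF _ le_square])
      then have "q dvd 2 \<or> 2 dvd q" using q(1) by (auto simp: prime_gt_0_nat)
      then show False using \<open>odd q\<close> q by (metis primes_dvd_imp_eq two_is_prime_nat)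
    qed
  qed
  then show ?thesis using q \<open>odd q\<close> m by auto
qed

section \<open>Cyclic subgroups and adjacency in the power graph\<close>

context group
begin

lemma power_graph_edge_iff:
  assumes "x \<in> carrier G" "y \<in> carrier G" "x \<noteq> y"
  shows "(x, y) \<in> edges (power_graph G) \<longleftrightarrow> x \<in> generate G {y} \<or> y \<in> generate G {x}"
  using assms by (auto simp: power_graph_def generate_pow)

lemma generate_mono_single:
  assumes "y \<in> carrier G" "x \<in> generate G {y}"
  shows "generate G {x} \<subseteq> generate G {y}"
  using assms by (intro generate_subgroup_incl generate_is_subgroup) auto

lemma ord_dvd_if_in_generate:
  assumes "y \<in> carrier G" "x \<in> generate G {y}"
  shows "ord x dvd ord y"
proof -
  obtain k :: int where k: "x = y [^] k" using assms by (auto simp: generate_pow)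
  then have "x [^] int (ord y) = (y [^] int (ord y)) [^] k"
    using assms(1) by (simp add: int_pow_pow mult.commute)
  also have "\<dots> = \<one>" using assms(1) by (simp add: int_pow_int)
  finally show ?thesis using assms(1) k by (simp add: int_pow_eq_id)
qed

lemma nonadjacent_if_ord_not_dvd:
  assumes "x \<in> carrier G" "y \<in> carrier G" "\<not> ord x dvd ord y" "\<not> ord y dvd ord x"
  shows "(x, y) \<notin> edges (power_graph G)"
proof -
  have "x \<noteq> y" using assms(3) by auto
  then show ?thesis
    using assms ord_dvd_if_in_generate by (auto simp: power_graph_edge_iff)
qed

lemma generate_inv:
  assumes "x \<in> carrier G"
  shows "generate G {inv x} = generate G {x}"
proof (rule antisym)
  have "generate G {inv y} \<subseteq> generate G {y}" if "y \<in> carrier G" for y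
    using that by (intro generate_mono_single) (auto intro: generate.inv)
  from this[of x] this[of "inv x"] assms
  show "generate G {inv x} \<subseteq> generate G {x}" "generate G {x} \<subseteq> generate G {inv x}"
    by auto
qed

lemma in_generate_inv:
  assumes "x \<in> carrier G" "y \<in> carrier G"
  shows "inv x \<in> generate G {y} \<longleftrightarrow> x \<in> generate G {y}"
  using generate_m_inv_closed[of "{y}" x] generate_m_inv_closed[of "{y}" "inv x"] assms by auto

lemma inv_eq_self_iff:
  assumes "x \<in> carrier G"
  shows "inv x = x \<longleftrightarrow> x \<otimes> x = \<one>"
  using assms by (metis inv_equality r_inv)

lemma generate_involution:
  assumes "a \<in> carrier G" "a \<otimes> a = \<one>"
  shows "generate G {a} = {\<one>, a}"
proof
  have "inv a = a" using assms by (simp add: inv_eq_self_iff)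
  then have "subgroup {\<one>, a} G" using assms by unfold_locales auto
  then show "generate G {a} \<subseteq> {\<one>, a}" by (intro generate_subgroup_incl) auto
qed (auto intro: generate.intros)

lemma nonadjacent_involutions:
  assumes "a \<in> carrier G" "b \<in> carrier G" "a \<otimes> a = \<one>" "b \<otimes> b = \<one>" "a \<noteq> \<one>" "b \<noteq> \<one>"
  shows "(a, b) \<notin> edges (power_graph G)"
  using assms irrefl_power_graph[of G]
  by (cases "a = b") (auto simp: power_graph_edge_iff generate_involution irrefl_def)

text \<open>An element and its inverse generate the same subgroup and lie in the same subgroups, so
  nonadjacency of \<open>x\<close> and \<open>y\<close> carries over to their inverses. The
  conditions on squares keep an element apart from its inverse. The short path serves when
  \<open>y\<close> is an involution.\<close>

lemma nonadjacent_path_inv: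
  assumes xy: "x \<in> carrier G" "y \<in> carrier G" "x \<noteq> y" "(x, y) \<notin> edges (power_graph G)"
    and sq: "x \<otimes> x \<noteq> \<one>"
  shows "nonadjacent_path (power_graph G) [x, y, inv x]"
    and "y \<otimes> y \<noteq> \<one> \<Longrightarrow> nonadjacent_path (power_graph G) [x, y, inv x, inv y]"
proof -
  have inc: "x \<notin> generate G {y}" "y \<notin> generate G {x}"
    using xy by (auto simp: power_graph_edge_iff)
  have 1: "x \<noteq> inv x" using xy sq inv_eq_self_iff[of x] by auto
  have 2: "x \<noteq> inv y" "y \<noteq> inv x"
    using inc xy by (metis generate.inv insertI1)+
  have 3: "(y, inv x) \<notin> edges (power_graph G)"
    using 2 inc xy by (auto simp: power_graph_edge_iff in_generate_inv generate_inv)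
  have "inv x \<noteq> inv y" using xy by (metis inv_inv)
  then have 4: "inv x \<noteq> inv y" "(inv x, inv y) \<notin> edges (power_graph G)"
    using inc xy by (auto simp: power_graph_edge_iff in_generate_inv generate_inv)
  show "nonadjacent_path (power_graph G) [x, y, inv x]"
    using xy 1 2 3 by (auto simp: nonadjacent_path_def)
  show "nonadjacent_path (power_graph G) [x, y, inv x, inv y]" if "y \<otimes> y \<noteq> \<one>"
    using xy 1 2 3 4 inv_eq_self_iff[of y] that by (auto simp: nonadjacent_path_def)
qed

section \<open>Complement paths on four vertices\<close>

lemma cyclic_group_iff_generate:
  "cyclic_group G \<longleftrightarrow> (\<exists>x\<in>carrier G. generate G {x} = carrier G)"
proof -
  have "generate G {x} = range (\<lambda>k::int. x [^] k)" if "x \<in> carrier G" for x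
    using generate_pow[OF that] by auto
  then show ?thesis unfolding cyclic_group by metis
qed

lemma square_eq_one_iff_ord:
  assumes "x \<in> carrier G"
  shows "x \<otimes> x = \<one> \<longleftrightarrow> ord x dvd 2"
  using assms pow_eq_id[of x 2] by (simp add: numeral_2_eq_2)

text \<open>All nonidentity elements are involutions and hence pairwise nonadjacent, so any four of
  them in any order will do.\<close>

lemma nonadjacent_path4_exponent_2:
  assumes fin: "finite (carrier G)" and "card (carrier G) > 4"
    and sq: "\<And>x. x \<in> carrier G \<Longrightarrow> x \<otimes> x = \<one>"
  shows "\<exists>ys. nonadjacent_path (power_graph G) ys \<and> length ys = 4"
proof -
  have "4 \<le> card (carrier G - {\<one>})" using assms by simp
  then obtain S where S: "S \<subseteq> carrier G - {\<one>}" "card S = 4" "finite S"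
    by (metis obtain_subset_with_card_n)
  then obtain ys where ys: "set ys = S" "distinct ys"
    using finite_distinct_list by blast
  then have "length ys = 4" using S distinct_card by metis
  moreover have "successively (\<lambda>x y. (x, y) \<notin> edges (power_graph G)) ys"
    unfolding successively_conv_nth
  proof (intro allI impI)
    fix i assume "Suc i < length ys"
    then have "ys ! i \<in> S" "ys ! Suc i \<in> S" using ys by auto
    then show "(ys ! i, ys ! Suc i) \<notin> edges (power_graph G)"
      using S sq by (intro nonadjacent_involutions) auto
  qed
  ultimately show ?thesis using ys S by (auto simp: nonadjacent_path_def)
qed

text \<open>An involution makes the order even, and order 2 would make the group cyclic of prime
  power order.\<close>

lemma exponent_2_order:
  assumes fin: "finite (carrier G)" and "\<not> trivial_group G"
    and "\<not> (cyclic_group G \<and> primepow (order G))"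
    and sq: "\<And>x. x \<in> carrier G \<Longrightarrow> x \<otimes> x = \<one>"
    and "order G \<le> 4"
  shows "order G = 4"
proof -
  obtain x where x: "x \<in> carrier G" "x \<noteq> \<one>"
    using assms(2) by (auto simp: trivial_group_def)
  then have "ord x dvd 2" using sq square_eq_one_iff_ord by blast
  moreover have "ord x \<noteq> 1" using x ord_eq_1 by blast
  ultimately have ord: "ord x = 2" by (metis prime_nat_iff two_is_prime_nat)
  then have "2 dvd order G" using ord_dvd_group_order[OF x(1)] by simp
  moreover have "order G > 0" using fin order_gt_0_iff_finite by simp
  moreover have "order G \<noteq> 2"
  proof
    assume "order G = 2"
    then have "card (generate G {x}) = card (carrier G)"
      using ord generate_pow_card[OF x(1)] by (simp add: order_def)
    moreover have "generate G {x} \<subseteq> carrier G" using x by (intro generate_incl) auto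
    ultimately have "generate G {x} = carrier G" using fin by (metis card_subset_eq)
    then have "cyclic_group G" using x cyclic_group_iff_generate by blast
    then show False using assms(3) \<open>order G = 2\<close> by simp
  qed
  ultimately show ?thesis using assms(5) by presburger
qed

lemma ord_generator:
  assumes "g \<in> carrier G" "generate G {g} = carrier G"
  shows "ord g = order G"
  using generate_pow_card[OF assms(1)] assms(2) by (simp add: order_def)

lemma exists_ord_eq_divisor:
  assumes "finite (carrier G)" "cyclic_group G" "d dvd order G"
  shows "\<exists>x\<in>carrier G. ord x = d"
proof -
  obtain g where g: "g \<in> carrier G" "generate G {g} = carrier G"
    using assms(2) cyclic_group_iff_generate by blast
  have pos: "order G > 0" using assms(1) order_gt_0_iff_finite by simp
  obtain e where e: "order G = d * e" using assms(3) by (elim dvdE)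
  with pos have "e \<noteq> 0" by auto
  then have "ord (g [^] e) = d"
    using ord_pow[of g e] g e ord_generator[OF g] by simp
  then show ?thesis using g by blast
qed

text \<open>Left multiplication by \<open>c\<close> preserves the complement of the subgroup
  generated by \<open>c\<close>. So the last three entries lie outside it and are involutions,
  pairwise nonadjacent. That the second and the fourth entry differ comes from
  \<open>c \<otimes> c \<noteq> \<one>\<close>.\<close>

lemma nonadjacent_path4_outside_cyclic:
  assumes c: "c \<in> carrier G" "c \<otimes> c \<noteq> \<one>"
    and t: "t \<in> carrier G" "t \<notin> generate G {c}"
    and out: "\<And>x. x \<in> carrier G \<Longrightarrow> x \<notin> generate G {c} \<Longrightarrow> x \<otimes> x = \<one>"
  shows "nonadjacent_path (power_graph G) [c, t, c \<otimes> t, c \<otimes> (c \<otimes> t)]"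
proof -
  interpret C: subgroup "generate G {c}" G
    using c by (intro generate_is_subgroup) auto
  have cC: "c \<in> generate G {c}" by (auto intro: generate.incl)
  have shift: "c \<otimes> x \<notin> generate G {c}" if "x \<in> carrier G" "x \<notin> generate G {c}" for x
  proof
    assume "c \<otimes> x \<in> generate G {c}"
    then have "inv c \<otimes> (c \<otimes> x) \<in> generate G {c}" using cC by blast
    then show False using that c by (simp add: inv_solve_left' flip: m_assoc)
  qed
  have o: "c \<otimes> t \<notin> generate G {c}" "c \<otimes> (c \<otimes> t) \<notin> generate G {c}"
    using shift t c by auto
  have c1: "c \<noteq> \<one>" using c by auto
  have nt: "(x, y) \<notin> edges (power_graph G)"
    if "x \<in> carrier G" "y \<in> carrier G" "x \<notin> generate G {c}" "y \<notin> generate G {c}" for x y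
    using that out C.one_closed by (intro nonadjacent_involutions) auto
  have "c \<notin> generate G {t}"
    using generate_involution[of t] out[OF t] t cC c1 by auto
  then have "(c, t) \<notin> edges (power_graph G)"
    using t c cC by (subst power_graph_edge_iff) auto
  moreover have "t \<noteq> c \<otimes> t" using c c1 t by (metis r_cancel_one')
  moreover have "t \<noteq> c \<otimes> (c \<otimes> t)" using c t by (metis m_assoc m_closed r_cancel_one')
  moreover have "c \<otimes> t \<noteq> c \<otimes> (c \<otimes> t)" using c c1 t by (metis m_closed r_cancel_one')
  moreover have "c \<noteq> t" "c \<noteq> c \<otimes> t" "c \<noteq> c \<otimes> (c \<otimes> t)" using cC t o by auto
  ultimately show ?thesis
    using c t o nt by (auto simp: nonadjacent_path_def)
qed

lemma nonadjacent_path4_or_exceptional: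
  assumes fin: "finite (carrier G)" and nontriv: "\<not> trivial_group G"
    and npp: "\<not> (cyclic_group G \<and> primepow (order G))"
  shows "(\<exists>ys. nonadjacent_path (power_graph G) ys \<and> length ys = 4) \<or>
    (order G = 4 \<and> (\<forall>x\<in>carrier G. x \<otimes> x = \<one>)) \<or>
    (\<exists>q. prime q \<and> odd q \<and> cyclic_group G \<and> order G = 2 * q)"
proof (rule ccontr)
  assume neg: "\<not> ?thesis"
  then have no_path: "\<not> (nonadjacent_path (power_graph G) ys \<and> length ys = 4)" for ys
    by blast
  \<comment> \<open>Without a path on four vertices, the elements of order at least 3 form a
    clique.\<close>
  have adj: "(x, y) \<in> edges (power_graph G)"
    if "x \<in> carrier G" "y \<in> carrier G" "x \<otimes> x \<noteq> \<one>" "y \<otimes> y \<noteq> \<one>" "x \<noteq> y" for x y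
    using nonadjacent_path_inv(2)[of x y] no_path[of "[x, y, inv x, inv y]"] that by auto
  define S where "S = {x \<in> carrier G. x \<otimes> x \<noteq> \<one>}"
  \<comment> \<open>If \<open>S\<close> is empty, the group has exponent 2: more than four elements
    yield a path, and otherwise the order is 4, the first exceptional case.\<close>
  have "S \<noteq> {}"
  proof
    assume "S = {}"
    then have sq: "\<And>x. x \<in> carrier G \<Longrightarrow> x \<otimes> x = \<one>" by (auto simp: S_def)
    then have "order G \<le> 4"
      using nonadjacent_path4_exponent_2[OF fin] no_path by (force simp: order_def)
    then show False using exponent_2_order[OF fin nontriv npp sq] neg sq by blast
  qed
  moreover have finS: "finite S" using fin by (simp add: S_def)
  \<comment> \<open>Take \<open>c\<close> of maximal order in \<open>S\<close>. If \<open>c\<close>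
    is a power of some \<open>x\<close> in \<open>S\<close>, the subgroup of \<open>x\<close>
    contains that of \<open>c\<close> and is no larger, so both coincide. Hence the subgroup of
    \<open>c\<close> contains all of \<open>S\<close>.\<close>
  ultimately have "Max (ord ` S) \<in> ord ` S" by simp
  then obtain c where c: "c \<in> S" "\<And>x. x \<in> S \<Longrightarrow> ord x \<le> ord c"
    using finS by (metis (no_types, lifting) Max_ge finite_imageI imageE imageI)
  then have cG: "c \<in> carrier G" "c \<otimes> c \<noteq> \<one>" by (auto simp: S_def)
  have S_sub: "x \<in> generate G {c}" if x: "x \<in> S" for x
  proof (cases "x = c")
    case True
    then show ?thesis by (auto intro: generate.incl)
  next
    case False
    have xG: "x \<in> carrier G" using x by (simp add: S_def)
    then have "x \<in> generate G {c} \<or> c \<in> generate G {x}"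
      using adj[of x c] x c(1) False by (auto simp: S_def power_graph_edge_iff)
    moreover have "x \<in> generate G {c}" if cx: "c \<in> generate G {x}"
    proof -
      have sub: "generate G {c} \<subseteq> generate G {x}" using generate_mono_single[OF xG cx] .
      moreover have finx: "finite (generate G {x})"
        using xG fin by (metis empty_subsetI finite_subset generate_incl insert_subset)
      moreover have "card (generate G {x}) \<le> card (generate G {c})"
        using c(2)[OF x] generate_pow_card xG cG by simp
      ultimately have "generate G {c} = generate G {x}" by (metis card_seteq)
      then show ?thesis by (auto intro: generate.incl)
    qed
    ultimately show ?thesis by blast
  qed
  have gen: "generate G {c} = carrier G"
  proof (rule ccontr)
    assume "generate G {c} \<noteq> carrier G"
    moreover have "generate G {c} \<subseteq> carrier G" using cG by (intro generate_incl) auto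
    ultimately obtain t where t: "t \<in> carrier G" "t \<notin> generate G {c}" by blast
    have "x \<otimes> x = \<one>" if "x \<in> carrier G" "x \<notin> generate G {c}" for x
      using S_sub[of x] that by (auto simp: S_def)
    from nonadjacent_path4_outside_cyclic[OF cG t this] no_path show False by force
  qed
  then have cyc: "cyclic_group G" using cG cyclic_group_iff_generate by blast
  have "card {\<one>, c} \<le> card (carrier G)" using fin cG by (intro card_mono) auto
  moreover have "\<one> \<noteq> c" using cG by auto
  ultimately have "order G > 1" by (simp add: order_def)
  moreover have "\<not> primepow (order G)" using npp cyc by simp
  \<comment> \<open>Incomparable divisors would be the orders of two nonadjacent elements; being at
    least 3, they place both elements in the clique \<open>S\<close>.\<close>
  moreover have "r dvd s \<or> s dvd r"
    if rs: "r dvd order G" "s dvd order G" "r \<ge> 3" "s \<ge> 3" for r s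
  proof (rule ccontr)
    assume nd: "\<not> (r dvd s \<or> s dvd r)"
    obtain x y where xy: "x \<in> carrier G" "y \<in> carrier G" "ord x = r" "ord y = s"
      using exists_ord_eq_divisor[OF fin cyc] rs by metis
    have "x \<otimes> x \<noteq> \<one>" "y \<otimes> y \<noteq> \<one>"
      using square_eq_one_iff_ord xy rs by (auto dest!: dvd_imp_le)
    moreover have "x \<noteq> y" using xy nd by auto
    ultimately show False
      using adj[of x y] nonadjacent_if_ord_not_dvd[of x y] nd xy by auto
  qed
  ultimately have "\<exists>q. prime q \<and> odd q \<and> order G = 2 * q"
    by (rule two_times_odd_prime_if_divisors_comparable)
  then show False using neg cyc by blast
qed

section \<open>The values of lambda for the exceptional groups\<close>

text \<open>A path on three vertices gives the bound \<open>2 * order G - 4\<close>; one on four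
  vertices makes it strict.\<close>

lemma lambda_number_le_if_nonadjacent_path:
  assumes "finite (carrier G)" "nonadjacent_path (power_graph G) ys" "ys \<noteq> []"
  shows "lambda_number (power_graph G) + length ys + 1 \<le> 2 * order G"
  using lambda_number_le_nonadjacent_path[OF sym_power_graph irrefl_power_graph, of G ys] assms
  by (simp add: nonadjacent_path_def order_def)

lemma one_adjacent:
  assumes "x \<in> carrier G" "x \<noteq> \<one>"
  shows "(\<one>, x) \<in> edges (power_graph G)" "(x, \<one>) \<in> edges (power_graph G)"
  using assms by (auto simp: power_graph_edge_iff intro: generate.one)

text \<open>Distinct nonadjacent elements are at distance two through the identity, so one of the
  two labeling conditions always applies.\<close>

lemma L21_labeling_power_graph_inj:
  assumes f: "L21_labeling (power_graph G) f" and xy: "x \<in> carrier G" "y \<in> carrier G" "x \<noteq> y"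
  shows "\<bar>int (f x) - int (f y)\<bar> \<ge> 1"
proof (cases "(x, y) \<in> edges (power_graph G)")
  case True
  then have "\<bar>int (f x) - int (f y)\<bar> \<ge> 2"
    using f xy unfolding L21_labeling_def by auto
  then show ?thesis by simp
next
  case False
  have "x \<noteq> \<one>" "y \<noteq> \<one>" using False one_adjacent xy by auto
  then have "graph_dist (power_graph G) x y = 2"
    using False xy one_adjacent by (intro graph_dist_eq_2I[where w = \<one>]) auto
  then show ?thesis using f xy unfolding L21_labeling_def by auto
qed

lemma exponent_2_order_4_carrier:
  assumes "order G = 4" "\<And>x. x \<in> carrier G \<Longrightarrow> x \<otimes> x = \<one>"
  obtains a b where "a \<in> carrier G" "b \<in> carrier G" "distinct [\<one>, a, b, a \<otimes> b]"
    "carrier G = {\<one>, a, b, a \<otimes> b}"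
proof -
  have fin: "finite (carrier G)" and card: "card (carrier G) = 4"
    using assms(1) order_gt_0_iff_finite by (auto simp: order_def)
  have "\<not> carrier G \<subseteq> {\<one>}" using card card_mono[of "{\<one>}" "carrier G"] by auto
  then obtain a where a: "a \<in> carrier G" "a \<noteq> \<one>" by blast
  have "card {\<one>, a} \<le> 2" by (simp add: card_insert_if)
  then have "\<not> carrier G \<subseteq> {\<one>, a}" using card card_mono[of "{\<one>, a}" "carrier G"] by auto
  then obtain b where b: "b \<in> carrier G" "b \<noteq> \<one>" "b \<noteq> a" by blast
  \<comment> \<open>Otherwise \<open>a \<otimes> b = a \<otimes> a\<close>, and cancelling gives
    \<open>b = a\<close>.\<close>
  have "a \<otimes> b \<noteq> \<one>" using a b assms(2)[of a] by (metis Units_eq Units_l_cancel)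
  moreover have "a \<otimes> b \<noteq> a" "a \<otimes> b \<noteq> b" using a b by (simp_all add: l_cancel_one r_cancel_one)
  ultimately have d: "distinct [\<one>, a, b, a \<otimes> b]" using a b by auto
  then have "card {\<one>, a, b, a \<otimes> b} = 4" by auto
  then have "carrier G = {\<one>, a, b, a \<otimes> b}"
    using card fin a b by (intro card_seteq[symmetric]) auto
  then show ?thesis using that a b d by blast
qed

text \<open>The three involutions form a complement path, which gives the upper bound. The power
  graph is a star, so the clique bound yields only 2; the lower bound instead counts the labels that
  the identity leaves free.\<close>

lemma lambda_number_exponent_2_order_4:
  assumes "order G = 4" and sq: "\<And>x. x \<in> carrier G \<Longrightarrow> x \<otimes> x = \<one>"
  shows "lambda_number (power_graph G) = 4"
proof (rule antisym)
  have fin: "finite (carrier G)" using assms(1) order_gt_0_iff_finite by auto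
  obtain a b where ab: "a \<in> carrier G" "b \<in> carrier G" "distinct [\<one>, a, b, a \<otimes> b]"
    using exponent_2_order_4_carrier[OF assms] by metis
  have "nonadjacent_path (power_graph G) [a, b, a \<otimes> b]"
    using ab sq by (auto simp: nonadjacent_path_def nonadjacent_involutions)
  from lambda_number_le_if_nonadjacent_path[OF fin this]
  show "lambda_number (power_graph G) \<le> 4" using assms(1) by simp
  show "4 \<le> lambda_number (power_graph G)"
  proof (rule lambda_number_geI)
    show "irrefl (edges (power_graph G))" "finite (verts (power_graph G))"
      using fin irrefl_power_graph by simp_all
    fix f assume f: "L21_labeling (power_graph G) f"
    have two: "\<bar>int (f \<one>) - int (f x)\<bar> \<ge> 2" if "x \<in> carrier G" "x \<noteq> \<one>" for x
      using f that one_adjacent unfolding L21_labeling_def by simp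
    define m where "m = Min (f ` carrier G)"
    have bounds: "m \<le> f x" "f x \<le> m + label_span (power_graph G) f" if "x \<in> carrier G" for x
      using that fin label_bounds[of "power_graph G" x f] by (simp_all add: m_def)
    show "4 \<le> label_span (power_graph G) f"
    proof (rule ccontr)
      assume "\<not> 4 \<le> label_span (power_graph G) f"
      then have le: "f x \<le> m + 3" if "x \<in> carrier G" for x
        using bounds(2)[OF that] by linarith
      \<comment> \<open>All labels lie in \<open>{m..m + 3}\<close>, and at most the two on the far side from the label of \<open>\<one>\<close> are left for the involutions.\<close>
      define k where "k = (if f \<one> \<le> m + 1 then m + 2 else m)"
      have "f x = k \<or> f x = k + 1" if x: "x \<in> carrier G" "x \<noteq> \<one>" for x
      proof (cases "f \<one> \<le> m + 1")
        case True
        then have "f x \<ge> m + 2" using two[OF x] bounds(1)[OF x(1)] bounds(1)[OF one_closed] by linarith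
        with True show ?thesis using le[OF x(1)] by (simp add: k_def) linarith
      next
        case False
        then have "f x \<le> m + 1" using two[OF x] le[OF x(1)] le[OF one_closed] by linarith
        with False show ?thesis using bounds(1)[OF x(1)] by (simp add: k_def) linarith
      qed
      moreover have ne: "a \<otimes> b \<in> carrier G" "a \<noteq> \<one>" "b \<noteq> \<one>" "a \<otimes> b \<noteq> \<one>" "a \<noteq> b"
        "a \<noteq> a \<otimes> b" "b \<noteq> a \<otimes> b" using ab by auto
      ultimately have "f a = k \<or> f a = k + 1" "f b = k \<or> f b = k + 1"
        "f (a \<otimes> b) = k \<or> f (a \<otimes> b) = k + 1" using ab by blast+
      moreover have "f a \<noteq> f b" "f a \<noteq> f (a \<otimes> b)" "f b \<noteq> f (a \<otimes> b)"
        using L21_labeling_power_graph_inj[OF f] ab(1,2) ne by fastforce+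
      ultimately show False by auto
    qed
  qed
qed

text \<open>Converse of \<open>ord_dvd_if_in_generate\<close> in a finite cyclic group; adjacency
  there amounts to comparability of orders.\<close>

lemma in_generate_if_ord_dvd:
  assumes fin: "finite (carrier G)" and "cyclic_group G"
    and uv: "u \<in> carrier G" "v \<in> carrier G" "ord u dvd ord v"
  shows "u \<in> generate G {v}"
proof -
  obtain g where g: "g \<in> carrier G" "generate G {g} = carrier G"
    using assms(2) cyclic_group_iff_generate by blast
  define N where "N = ord g"
  have N: "N > 0" using ord_ge_1[OF fin g(1)] by (simp add: N_def)
  obtain i j :: nat where ij: "u = g [^] i" "v = g [^] j"
    using uv(1,2) unfolding g(2)[symmetric] generate_pow_on_finite_carrier[OF fin g(1)] by blast
  \<comment> \<open>The powers \<open>g [^] d\<close> and \<open>g [^] j\<close> generate the same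
    subgroup, so the goal reduces to \<open>d dvd i\<close>.\<close>
  define d where "d = gcd N j"
  have d: "d > 0" "d dvd N" using N by (simp_all add: d_def)
  have "ord v = N div d"
    using ord_pow_gen[OF g(1), of j] ij N by (auto simp: d_def N_def)
  then have "u [^] (N div d) = \<one>" using uv by (simp add: pow_eq_id)
  then have "N dvd i * (N div d)" using g ij by (simp add: nat_pow_pow pow_eq_id N_def)
  moreover have "N = d * (N div d)" "N div d > 0" using d N by (auto simp: div_greater_zero_iff dvd_imp_le)
  ultimately have "d dvd i" by (metis dvd_times_right_cancel_iff less_numeral_extra(3))
  then obtain e where e: "i = d * e" by (elim dvdE)
  \<comment> \<open>By Bezout, \<open>d\<close> and hence its multiple \<open>i\<close> is a
    multiple of \<open>j\<close> modulo \<open>N\<close>, which exhibits \<open>u\<close> as a power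
    of \<open>v\<close>.\<close>
  obtain x y where "x * int N + y * int j = gcd (int N) (int j)"
    using bezout_int by blast
  then have xy: "x * int N + y * int j = int d" by (simp add: d_def)
  have "int i = (x * int N + y * int j) * int e" using e xy by simp
  also have "\<dots> = int j * (y * int e) + int N * (x * int e)" by (simp add: algebra_simps)
  finally have "int N dvd (int j * (y * int e) - int i)" by simp
  then have "g [^] int i = g [^] (int j * (y * int e))"
    using g by (simp add: int_pow_eq N_def)
  then have "u = v [^] (y * int e)"
    using g ij by (simp add: int_pow_int int_pow_pow flip: int_pow_int)
  then show ?thesis using uv by (auto simp: generate_pow)
qed

text \<open>An element of order \<open>q\<close>, the involution and the inverse of that element
  form a complement path, which gives the upper bound. Outside the involution only the orders 1,
  \<open>q\<close> and \<open>2 * q\<close> occur, a chain under divisibility; so the other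
  \<open>2 * q - 1\<close> elements form a clique and the clique bound is
  \<open>4 * q - 4\<close>.\<close>

lemma lambda_number_cyclic_2q:
  assumes q: "prime q" "odd q" and G: "cyclic_group G" "order G = 2 * q"
  shows "int (lambda_number (power_graph G)) = 2 * int (order G) - 4"
proof -
  have q3: "q \<ge> 3" using q prime_ge_2_nat[of q] by (cases "q = 2") auto
  have fin: "finite (carrier G)" using G(2) q3 order_gt_0_iff_finite by simp
  obtain x t where x: "x \<in> carrier G" "ord x = q" and t: "t \<in> carrier G" "ord t = 2"
    using exists_ord_eq_divisor[OF fin G(1), of q] exists_ord_eq_divisor[OF fin G(1), of 2] G(2)
    by auto
  have nd: "\<not> q dvd 2" "\<not> 2 dvd q" using q q3 by (auto dest: dvd_imp_le)
  then have "(x, t) \<notin> edges (power_graph G)" "x \<noteq> t" "x \<otimes> x \<noteq> \<one>"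
    using x t nonadjacent_if_ord_not_dvd square_eq_one_iff_ord by auto
  then have "nonadjacent_path (power_graph G) [x, t, inv x]"
    using x t nonadjacent_path_inv(1) by blast
  from lambda_number_le_if_nonadjacent_path[OF fin this]
  have upper: "lambda_number (power_graph G) + 4 \<le> 2 * order G" by simp
  have tt: "t \<otimes> t = \<one>" using t square_eq_one_iff_ord by simp
  define K where "K = carrier G - {t}"
  have ordK: "ord u \<in> {1, q, 2 * q}" if u: "u \<in> K" for u
  proof -
    have uG: "u \<in> carrier G" "u \<noteq> t" using u by (auto simp: K_def)
    have "ord u dvd 2 * q" using ord_dvd_group_order[OF uG(1)] G(2) by simp
    then obtain a b where ab: "ord u = a * b" "a dvd 2" "b dvd q"
      by (metis division_decomp)
    have "a = 1 \<or> a = 2" "b = 1 \<or> b = q"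
      using ab q(1) two_is_prime_nat by (metis prime_nat_iff)+
    \<comment> \<open>An element of order 2 lies in the subgroup generated by \<open>t\<close>, so
      \<open>t\<close> is the only involution.\<close>
    moreover have "ord u \<noteq> 2"
    proof
      assume "ord u = 2"
      then have "u \<in> generate G {t}" using in_generate_if_ord_dvd[OF fin G(1) uG(1)] t by simp
      then have "u = \<one>" using generate_involution[OF t(1) tt] uG by auto
      then show False using \<open>ord u = 2\<close> by simp
    qed
    ultimately show ?thesis using ab by auto
  qed
  have "(u, v) \<in> edges (power_graph G)" if "u \<in> K" "v \<in> K" "u \<noteq> v" for u v
  proof -
    have "ord u dvd ord v \<or> ord v dvd ord u"
      using ordK[OF that(1)] ordK[OF that(2)] by auto
    then show ?thesis
      using that in_generate_if_ord_dvd[OF fin G(1)] by (auto simp: K_def power_graph_edge_iff)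
  qed
  then have "2 * (card K - 1) \<le> lambda_number (power_graph G)"
    using fin by (intro lambda_number_ge_clique irrefl_power_graph) (auto simp: K_def)
  moreover have "card K = order G - 1" using t fin by (simp add: K_def order_def)
  ultimately show ?thesis using upper G(2) q3 by linarith
qed

section \<open>Recognizing the exceptional groups up to isomorphism\<close>

lemma iso_integer_mod_group_iff:
  assumes "m > 1"
  shows "G \<cong> integer_mod_group m \<longleftrightarrow> cyclic_group G \<and> order G = m"
proof
  let ?Z = "integer_mod_group m"
  assume iso: "G \<cong> ?Z"
  interpret Z: group ?Z by simp
  have "1 \<in> carrier ?Z" using assms by simp
  moreover have "carrier ?Z = range (\<lambda>k::int. 1 [^]\<^bsub>?Z\<^esub> k)"
  proof -
    have "x \<in> range (\<lambda>k. k mod int m)" if "x \<in> {0..<int m}" for x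
      using that by (intro range_eqI[of _ _ x]) auto
    then show ?thesis
      using assms by (auto simp: carrier_integer_mod_group int_pow_integer_mod_group)
  qed
  ultimately have "cyclic_group ?Z" using Z.cyclic_group by blast
  then have "cyclic_group G"
    using isomorphic_group_cyclicity[OF iso is_group] by simp
  moreover have "order G = m"
    using iso_same_card[OF iso] assms by (simp add: order_def carrier_integer_mod_group)
  ultimately show "cyclic_group G \<and> order G = m" by blast
next
  let ?Z = "integer_mod_group m"
  assume G: "cyclic_group G \<and> order G = m"
  then obtain g where g: "g \<in> carrier G" "generate G {g} = carrier G"
    using cyclic_group_iff_generate by blast
  then have ord: "ord g = m" using ord_generator G by simp
  have fin: "finite (carrier G)" using G assms order_gt_0_iff_finite by simp
  let ?h = "\<lambda>k::int. g [^] k"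
  have eq: "g [^] k = g [^] l \<longleftrightarrow> int m dvd l - k" for k l :: int
    using int_pow_eq[OF g(1)] ord by simp
  \<comment> \<open>Reduction modulo \<open>m\<close> in the exponent is harmless because
    \<open>g\<close> has order \<open>m\<close>.\<close>
  have "?h \<in> hom ?Z G"
  proof (rule homI)
    fix k l
    have "?h ((k + l) mod int m) = ?h (k + l)"
      by (simp add: eq mod_eq_dvd_iff[symmetric])
    then show "?h (k \<otimes>\<^bsub>?Z\<^esub> l) = ?h k \<otimes> ?h l" using g by (simp add: int_pow_mult)
  qed (use g in auto)
  moreover have "bij_betw ?h (carrier ?Z) (carrier G)"
  proof (rule bij_betw_imageI)
    show inj: "inj_on ?h (carrier ?Z)"
    proof (rule inj_onI)
      fix k l assume "k \<in> carrier ?Z" "l \<in> carrier ?Z" "?h k = ?h l"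
      then have "l mod int m = k mod int m" and kl: "k \<in> {0..<int m}" "l \<in> {0..<int m}"
        using assms eq mod_eq_dvd_iff[of l "int m" k] by (simp_all add: carrier_integer_mod_group)
      moreover have "k mod int m = k" "l mod int m = l" using kl by simp_all
      ultimately show "k = l" by simp
    qed
    \<comment> \<open>Both groups have \<open>m\<close> elements, so injectivity suffices.\<close>
    show "?h ` carrier ?Z = carrier G"
    proof (rule card_subset_eq[OF fin])
      show "card (?h ` carrier ?Z) = card (carrier G)"
        using card_image[OF inj] G assms by (simp add: order_def carrier_integer_mod_group)
    qed (use g in auto)
  qed
  ultimately have "?h \<in> iso ?Z G" by (rule isoI)
  then have "?Z \<cong> G" by (rule is_isoI)
  then show "G \<cong> ?Z" by (rule group.iso_sym[OF group_integer_mod_group])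
qed

lemma iso_Klein_four_iff:
  "G \<cong> integer_mod_group 2 \<times>\<times> integer_mod_group 2 \<longleftrightarrow>
     order G = 4 \<and> (\<forall>x\<in>carrier G. x \<otimes> x = \<one>)"
proof
  let ?V = "integer_mod_group 2 \<times>\<times> integer_mod_group 2"
  have carr: "carrier ?V = {0, 1} \<times> {0, 1}"
    by (auto simp: carrier_integer_mod_group)
  interpret V: group ?V by (simp add: DirProd_group)
  {
    assume iso: "G \<cong> ?V"
    then obtain h where h: "h \<in> hom G ?V" "bij_betw h (carrier G) (carrier ?V)"
      by (auto simp: is_iso_def iso_def)
    have "x \<otimes> x = \<one>" if x: "x \<in> carrier G" for x
    proof -
      have hx: "h x \<in> carrier ?V" using h x by (auto simp: hom_def)
      then have "h x \<otimes>\<^bsub>?V\<^esub> h x = \<one>\<^bsub>?V\<^esub>"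
        unfolding carr by (auto simp: DirProd_def)
      then have "h (x \<otimes> x) = h \<one>"
        using h(1) x hom_one[OF h(1) is_group V.is_group] by (simp add: hom_mult)
      then show ?thesis using h(2) x by (auto simp: bij_betw_def inj_on_def)
    qed
    moreover have "order G = 4"
      using iso_same_card[OF iso] unfolding carr by (simp add: order_def)
    ultimately show "order G = 4 \<and> (\<forall>x\<in>carrier G. x \<otimes> x = \<one>)" by blast
  next
    assume G: "order G = 4 \<and> (\<forall>x\<in>carrier G. x \<otimes> x = \<one>)"
    then obtain a b where ab: "a \<in> carrier G" "b \<in> carrier G" "distinct [\<one>, a, b, a \<otimes> b]"
      "carrier G = {\<one>, a, b, a \<otimes> b}"
      using exponent_2_order_4_carrier by blast
    have sq: "x \<otimes> x = \<one>" if "x \<in> carrier G" for x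
      using G that by blast
    have sq': "x \<otimes> (x \<otimes> y) = y" if "x \<in> carrier G" "y \<in> carrier G" for x y
      using sq that by (simp flip: m_assoc)
    have comm: "x \<otimes> y = y \<otimes> x" if "x \<in> carrier G" "y \<in> carrier G" for x y
      using sq that by (metis inv_eq_self_iff inv_mult_group m_closed)
    have ba: "b \<otimes> a = a \<otimes> b" using comm ab by blast
    have bab: "b \<otimes> (a \<otimes> b) = a" using sq'[OF ab(2,1)] ba by simp
    \<comment> \<open>This sends \<open>(i, j)\<close> to the product of the \<open>i\<close>-th
      power of \<open>a\<close> and the \<open>j\<close>-th power of \<open>b\<close>, for exponents
      0 and 1. The preceding identities evaluate all products of right-nested words, so the
      homomorphism law is checked on sixteen pairs.\<close>
    define h :: "int \<times> int \<Rightarrow> 'a"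
      where "h p = (if fst p = 0 then \<one> else a) \<otimes> (if snd p = 0 then \<one> else b)" for p
    have h: "h (0, 0) = \<one>" "h (0, 1) = b" "h (1, 0) = a" "h (1, 1) = a \<otimes> b"
      using ab(1,2) by (simp_all add: h_def)
    have cases: "p = (0, 0) \<or> p = (0, 1) \<or> p = (1, 0) \<or> p = (1, 1)" if "p \<in> carrier ?V" for p
      using that unfolding carr by blast
    have "h \<in> hom ?V G"
    proof (rule homI)
      fix p assume "p \<in> carrier ?V"
      then show "h p \<in> carrier G" using cases[of p] h ab(1,2) by auto
      fix r assume "r \<in> carrier ?V"
      with \<open>p \<in> carrier ?V\<close> have "p = (0, 0) \<or> p = (0, 1) \<or> p = (1, 0) \<or> p = (1, 1)"
        "r = (0, 0) \<or> r = (0, 1) \<or> r = (1, 0) \<or> r = (1, 1)"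
        using cases by blast+
      then show "h (p \<otimes>\<^bsub>?V\<^esub> r) = h p \<otimes> h r"
        by (elim disjE) (simp_all add: h ab(1,2) m_assoc sq sq' ba bab)
    qed
    moreover have "bij_betw h (carrier ?V) (carrier G)"
    proof (rule bij_betw_imageI)
      have "distinct [h (0, 0), h (1, 0), h (0, 1), h (1, 1)]" using ab(3) unfolding h .
      then show "inj_on h (carrier ?V)" unfolding carr by (auto simp: inj_on_def)
      show "h ` carrier ?V = carrier G" unfolding carr ab(4) by (auto simp: h)
    qed
    ultimately have "?V \<cong> G" by (intro is_isoI isoI)
    then show "G \<cong> ?V" by (rule V.iso_sym)
  }
qed

end

theorem theorem4p1:
  fixes G :: "('a, 'b) monoid_scheme" and n :: nat
  assumes "group G"
    and "finite (carrier G)"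
    and "order G = n"
    and "\<not> trivial_group G"
    and "\<not> (cyclic_group G \<and> primepow n)"
  shows "int (lambda_number (power_graph G)) \<le> 2 * int n - 4 \<and>
    (int (lambda_number (power_graph G)) = 2 * int n - 4 \<longleftrightarrow>
      G \<cong> integer_mod_group 2 \<times>\<times> integer_mod_group 2 \<or>
      (\<exists>q :: nat. prime q \<and> odd q \<and> G \<cong> integer_mod_group (2 * q)))"
proof -
  interpret group G by fact
  let ?exc = "G \<cong> integer_mod_group 2 \<times>\<times> integer_mod_group 2 \<or>
      (\<exists>q :: nat. prime q \<and> odd q \<and> G \<cong> integer_mod_group (2 * q))"
  have iso: "G \<cong> integer_mod_group (2 * q) \<longleftrightarrow> cyclic_group G \<and> order G = 2 * q"
    if "prime q" for q
    using prime_gt_1_nat[OF that] by (intro iso_integer_mod_group_iff) simp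
  have exc: "int (lambda_number (power_graph G)) = 2 * int n - 4" if ?exc
    using that iso lambda_number_cyclic_2q lambda_number_exponent_2_order_4 assms(3)
    by (auto simp: iso_Klein_four_iff)
  \<comment> \<open>Strictness outside the exceptional groups yields both the bound and the only-if
    direction of the equality case.\<close>
  have "int (lambda_number (power_graph G)) < 2 * int n - 4" if nexc: "\<not> ?exc"
  proof -
    have "\<not> (order G = 4 \<and> (\<forall>x\<in>carrier G. x \<otimes>\<^bsub>G\<^esub> x = \<one>\<^bsub>G\<^esub>))"
      using nexc iso_Klein_four_iff by blast
    moreover have "\<not> (\<exists>q. prime q \<and> odd q \<and> cyclic_group G \<and> order G = 2 * q)"
      using nexc iso by blast
    ultimately obtain ys where "nonadjacent_path (power_graph G) ys" "length ys = 4"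
      using nonadjacent_path4_or_exceptional[OF assms(2,4)] assms(3,5) by blast
    then show ?thesis
      using lambda_number_le_if_nonadjacent_path[OF assms(2), of ys] assms(3) by force
  qed
  with exc show ?thesis by (cases ?exc) auto
qed

end
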